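(* (QHI-preserving property.) Consider any execution of the LL/SC algorithm given in the context. If at point $t$ every process is idle and has no outstanding LL operation, then at point $t$ all values $C[i]$ ($1\le i\le m$), all values $R[g]$ ($1\le g\le 2k$), and all tag fields $L[i].\mathrm{tag}$ ($1\le i\le m$) are zero.
   Context: Model. $n$ asynchronous processes communicate by atomic operations (steps) on shared objects. A CAS object supports $\mathrm{Read}()$ and $\mathrm{CAS}(old,new)$, which, if the current value equals $old$, writes $new$ and returns True (success), and otherwise returns False and changes nothing (failure). A FAID object stores an integer in a range $\{0,\dots,M-1\}$ and supports $\mathrm{Read}()$, $\mathrm{FAI}()$, $\mathrm{FAD}()$; each returns the current value, and FAI/FAD additionally increment/decrement it (leaving the range would be an overflow, with unspecified effect). Each process performs method calls one at a time; it is idle if it has no pending call. Steps are arbitrarily interleaved. A point is the time of an event of the execution. Local computation takes no time; a call (also an internal one) responds at the point of its last shared memory step (or at its invocation if it has none). Data. Constants: $U$ = set of values, $m$ objects, $n$ processes, bound $k\ge 1$. Shared: CAS objects $L[i]$, $1\le i\le m$, storing pairs (val, tag) in $U\times\{0,\dots,2k\}$, initially $(u_i,0)$ with given $u_i\in U$; FAID objects $C[i]$, $1\le i\le m$, range $\{0,\dots,n\}$, initially $0$; FAID objects $R[g]$, $1\le g\le 2k$, range $\{0,\dots,k\}$, initially $0$. Each process has a local persistent dictionary $d$ with keys $1,\dots,m$ and values in $U\times\{0,\dots,2k\}$ or $\bot$ (initially all $\bot$). $x.\mathrm{val}$, $x.\mathrm{tag}$ are the components of a pair $x$. Algorithm ($i\in\{1,\dots,m\}$,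 $u\in U$). LL(i): (L1) if $d[i]\ne\bot$, call CL(i). (L2) $C[i].\mathrm{FAI}()$. (L3) $(val,tag)\gets L[i].\mathrm{Read}()$. (L4) $d[i]\gets(val,tag)$. (L5) if $tag=0$ return $val$. (L6) $R[tag].\mathrm{FAI}()$. (L7) $(val',tag')\gets L[i].\mathrm{Read}()$. (L8) if $(val,tag)=(val',tag')$ return $val'$. (L9) if $tag'=0$: $R[tag].\mathrm{FAD}()$; $d[i]\gets(val',0)$; return $val'$. (L10) call CL(i). (L11) return $val$. SC(i,u): (S1) if $d[i]=\bot$ return False. (S2) repeat: $tag'\gets$ uniform independent random sample from $\{1,\dots,2k\}$; until $R[tag'].\mathrm{Read}()=0$. (S3) $result\gets L[i].\mathrm{CAS}(d[i],(u,tag'))$. (S4) if $result$ = False, $result\gets L[i].\mathrm{CAS}((d[i].\mathrm{val},0),(u,tag'))$. (S5) call CL(i). (S6) return $result$. CL(i): (K1) if $d[i]=\bot$ return. (K2) if $d[i].\mathrm{tag}\ne0$, $R[d[i].\mathrm{tag}].\mathrm{FAD}()$. (K3) $d[i]\gets\bot$. (K4) if $C[i].\mathrm{FAD}()>1$ return. (K5) $(val,tag)\gets L[i].\mathrm{Read}()$. (K6) if $tag=0$ return. (K7) $R[tag].\mathrm{FAI}()$. (K8) if $L[i].\mathrm{Read}()=(val,tag)$ then (K9) if $C[i].\mathrm{Read}()=0$ then (K10) $L[i].\mathrm{CAS}((val,tag),(val,0))$. (K11) $R[tag].\mathrm{FAD}()$. Read(i): return $L[i].\mathrm{Read}().\mathrm{val}$.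 VL(i): (V1) if $d[i]=\bot$ return False. (V2) if $L[i].\mathrm{Read}().\mathrm{tag}\in\{d[i].\mathrm{tag},0\}$ return True. (V3) call CL(i). (V4) return False. Outstanding LL. A process begins to have an outstanding LL(i) when it invokes LL(i), and ceases to have it when it completes an SC(i,·), a CL(i), or a VL(i) returning False (only calls made directly, not internal CL calls, count). A process has at most one outstanding LL per object. Standing assumption: at every point, the total number of outstanding LL operations over all processes and objects is at most $k$. The claim is for every execution, whatever the interleaving and the random outcomes. *)

theory Defs
  imports Main "HOL-Library.Extended_Nat"
begin

text \<open>
  The algorithm, with the line labels used as program counters below:

  LL(i):   L1  if d[i] is defined, call CL(i)
           L2  C[i].FAI()
           L3  (val, tag) := L[i].Read()
           L4  d[i] := (val, tag)
           L5  if tag = 0 return val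
           L6  R[tag].FAI()
           L7  (val', tag') := L[i].Read()
           L8  if (val, tag) = (val', tag') return val'
           L9  if tag' = 0: R[tag].FAD(); d[i] := (val', 0); return val'
           L10 call CL(i)
           L11 return val
  SC(i,u): S1  if d[i] is undefined return False
           S2  repeat tag' := random sample from 1..2k until R[tag'].Read() = 0
           S3  result := L[i].CAS(d[i], (u, tag'))
           S4  if not result: result := L[i].CAS((d[i].val, 0), (u, tag'))
           S5  call CL(i)
           S6  return result
  CL(i):   K1  if d[i] is undefined return
           K2  if d[i].tag is not 0: R[d[i].tag].FAD()
           K3  make d[i] undefined
           K4  if C[i].FAD() > 1 return
           K5  (val, tag) := L[i].Read()
           K6  if tag = 0 return
           K7  R[tag].FAI()
           K8  if L[i].Read() = (val, tag) then
           K9    if C[i].Read() = 0 then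
           K10     L[i].CAS((val, tag), (val, 0))
           K11 R[tag].FAD()
  Read(i): RD  return L[i].Read().val
  VL(i):   V1  if d[i] is undefined return False
           V2  if L[i].Read().tag is d[i].tag or 0 return True
           V3  call CL(i)
           V4  return False

  Local computation takes no time: a transition consists of one event (an invocation or one
  shared memory operation) together with all local computation up to the next shared memory
  operation or the response. A call without shared memory operations therefore responds at its
  invocation, and lines without a shared memory operation have no program counter.
\<close>

type_synonym 'u cell = "'u \<times> nat"  \<comment> \<open>(val, tag)\<close>

datatype 'u call = LL nat | SC nat 'u | CL nat | Read nat | VL nat

datatype 'u response = Value 'u | Bool bool | Done

fun obj :: "'u call \<Rightarrow> nat" where
  "obj (LL i) = i"
| "obj (SC i u) = i"
| "obj (CL i) = i"
| "obj (Read i) = i"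
| "obj (VL i) = i"

text \<open>
  The place from which CL was called, with the local variables of the caller that are still
  needed: the value to be returned at L11 or S6.
\<close>

datatype 'u cl_site = At_L1 | At_L10 'u | At_S5 bool | At_V3 | Direct

text \<open>
  A program counter names the shared memory operation to be performed next and carries the live
  local variables: (val, tag) in L6, L7 and K7 to K11, (tag, val') in L9, and tag' in S3 and S4.
\<close>

datatype 'u pc =
    L2 | L3 | L6 'u nat | L7 'u nat | L9 nat 'u
  | S2 | S3 nat | S4 nat
  | K2 "'u cl_site" | K4 "'u cl_site" | K5 "'u cl_site"
  | K7 "'u cl_site" 'u nat | K8 "'u cl_site" 'u nat | K9 "'u cl_site" 'u nat
  | K10 "'u cl_site" 'u nat | K11 "'u cl_site" 'u nat
  | RD
  | V2

text \<open>
  \<open>dict s p i\<close> is entry i of the dictionary of process p, \<open>ctrl s p\<close> is the pending call of p with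
  its program counter (\<open>None\<close> if p is idle), and \<open>(p, i) \<in> outstanding s\<close> means that p has an
  outstanding LL(i). The last component is only bookkeeping: no transition depends on it.
\<close>

record 'u config =
  cas_L :: "nat \<Rightarrow> 'u cell"
  faid_C :: "nat \<Rightarrow> nat"
  faid_R :: "nat \<Rightarrow> nat"
  dict :: "nat \<Rightarrow> nat \<Rightarrow> 'u cell option"
  ctrl :: "nat \<Rightarrow> ('u call \<times> 'u pc) option"
  outstanding :: "(nat \<times> nat) set"

definition idle :: "'u config \<Rightarrow> nat \<Rightarrow> bool" where
  "idle s p \<longleftrightarrow> ctrl s p = None"

text \<open>
  FAI and FAD on a FAID object with range 0..M-1: current value v, returned value r, new value v'.
  On overflow r and v' are unconstrained.
\<close>

definition fai :: "nat \<Rightarrow> nat \<Rightarrow> nat \<Rightarrow> nat \<Rightarrow> bool" where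
  "fai M v r v' \<longleftrightarrow> (v + 1 < M \<longrightarrow> r = v \<and> v' = v + 1)"

definition fad :: "nat \<Rightarrow> nat \<Rightarrow> nat \<Rightarrow> nat \<Rightarrow> bool" where
  "fad M v r v' \<longleftrightarrow> (0 < v \<and> v < M \<longrightarrow> r = v \<and> v' = v - 1)"

definition write_L :: "nat \<Rightarrow> 'u cell \<Rightarrow> 'u config \<Rightarrow> 'u config" where
  "write_L i x s = s\<lparr>cas_L := (cas_L s)(i := x)\<rparr>"

definition write_C :: "nat \<Rightarrow> nat \<Rightarrow> 'u config \<Rightarrow> 'u config" where
  "write_C i x s = s\<lparr>faid_C := (faid_C s)(i := x)\<rparr>"

definition write_R :: "nat \<Rightarrow> nat \<Rightarrow> 'u config \<Rightarrow> 'u config" where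
  "write_R g x s = s\<lparr>faid_R := (faid_R s)(g := x)\<rparr>"

definition set_dict :: "nat \<Rightarrow> nat \<Rightarrow> 'u cell option \<Rightarrow> 'u config \<Rightarrow> 'u config" where
  "set_dict p i x s = s\<lparr>dict := (dict s)(p := (dict s p)(i := x))\<rparr>"

definition goto :: "nat \<Rightarrow> 'u call \<Rightarrow> 'u pc \<Rightarrow> 'u config \<Rightarrow> 'u config" where
  "goto p c l s = s\<lparr>ctrl := (ctrl s)(p := Some (c, l))\<rparr>"

fun ends_outstanding :: "'u call \<Rightarrow> 'u response \<Rightarrow> bool" where
  "ends_outstanding (SC i u) r = True"
| "ends_outstanding (CL i) r = True"
| "ends_outstanding (VL i) r = (r = Bool False)"
| "ends_outstanding (LL i) r = False"
| "ends_outstanding (Read i) r = False"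

definition respond :: "nat \<Rightarrow> 'u call \<Rightarrow> 'u response \<Rightarrow> 'u config \<Rightarrow> 'u config" where
  "respond p c r s = s\<lparr>
     ctrl := (ctrl s)(p := None),
     outstanding :=
       (if ends_outstanding c r then outstanding s - {(p, obj c)} else outstanding s)\<rparr>"

text \<open>What the process does when CL, called at the given place of the pending call c, returns.\<close>

fun return_CL :: "nat \<Rightarrow> 'u call \<Rightarrow> 'u cl_site \<Rightarrow> 'u config \<Rightarrow> 'u config" where
  "return_CL p c At_L1 s = goto p c L2 s"
| "return_CL p c (At_L10 v) s = respond p c (Value v) s"
| "return_CL p c (At_S5 b) s = respond p c (Bool b) s"
| "return_CL p c At_V3 s = respond p c (Bool False) s"
| "return_CL p c Direct s = respond p c Done s"

definition enter_CL :: "nat \<Rightarrow> 'u call \<Rightarrow> 'u cl_site \<Rightarrow> 'u config \<Rightarrow> 'u config" where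
  "enter_CL p c site s =
     (case dict s p (obj c) of
        None \<Rightarrow> return_CL p c site s
      | Some (v, tag) \<Rightarrow>
          if tag \<noteq> 0 then goto p c (K2 site) s
          else goto p c (K4 site) (set_dict p (obj c) None s))"

fun invoke :: "nat \<Rightarrow> 'u call \<Rightarrow> 'u config \<Rightarrow> 'u config" where
  "invoke p (LL i) s =
     (let s' = s\<lparr>outstanding := insert (p, i) (outstanding s)\<rparr> in
      if dict s p i \<noteq> None then enter_CL p (LL i) At_L1 s' else goto p (LL i) L2 s')"
| "invoke p (SC i u) s =
     (if dict s p i = None then respond p (SC i u) (Bool False) s else goto p (SC i u) S2 s)"
| "invoke p (CL i) s = enter_CL p (CL i) Direct s"
| "invoke p (Read i) s = goto p (Read i) RD s"
| "invoke p (VL i) s =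
     (if dict s p i = None then respond p (VL i) (Bool False) s else goto p (VL i) V2 s)"

text \<open>
  A shared memory step of process p. The sample of S2 is drawn together with the following read of
  R; a random outcome is any element of its support.
\<close>

inductive mem_step :: "nat \<Rightarrow> nat \<Rightarrow> nat \<Rightarrow> 'u config \<Rightarrow> 'u config \<Rightarrow> bool"
  for n k p :: nat where
  step_L2: "\<lbrakk>ctrl s p = Some (LL i, L2); fai (n + 1) (faid_C s i) r x\<rbrakk> \<Longrightarrow>
    mem_step n k p s (goto p (LL i) L3 (write_C i x s))"
| step_L3: "\<lbrakk>ctrl s p = Some (LL i, L3); cas_L s i = (v, tag);
      s' = set_dict p i (Some (v, tag)) s\<rbrakk> \<Longrightarrow>
    mem_step n k p s
      (if tag = 0 then respond p (LL i) (Value v) s' else goto p (LL i) (L6 v tag) s')"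
| step_L6: "\<lbrakk>ctrl s p = Some (LL i, L6 v tag); fai (k + 1) (faid_R s tag) r x\<rbrakk> \<Longrightarrow>
    mem_step n k p s (goto p (LL i) (L7 v tag) (write_R tag x s))"
| step_L7: "\<lbrakk>ctrl s p = Some (LL i, L7 v tag); cas_L s i = (v', tag')\<rbrakk> \<Longrightarrow>
    mem_step n k p s
      (if (v, tag) = (v', tag') then respond p (LL i) (Value v') s
       else if tag' = 0 then goto p (LL i) (L9 tag v') s
       else enter_CL p (LL i) (At_L10 v) s)"
| step_L9: "\<lbrakk>ctrl s p = Some (LL i, L9 tag v'); fad (k + 1) (faid_R s tag) r x\<rbrakk> \<Longrightarrow>
    mem_step n k p s
      (respond p (LL i) (Value v') (set_dict p i (Some (v', 0)) (write_R tag x s)))"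
| step_S2: "\<lbrakk>ctrl s p = Some (SC i u, S2); tag' \<in> {1..2 * k}\<rbrakk> \<Longrightarrow>
    mem_step n k p s
      (if faid_R s tag' = 0 then goto p (SC i u) (S3 tag') s else goto p (SC i u) S2 s)"
| step_S3: "\<lbrakk>ctrl s p = Some (SC i u, S3 tag'); dict s p i = Some (v, tag)\<rbrakk> \<Longrightarrow>
    mem_step n k p s
      (if cas_L s i = (v, tag) then enter_CL p (SC i u) (At_S5 True) (write_L i (u, tag') s)
       else goto p (SC i u) (S4 tag') s)"
| step_S4: "\<lbrakk>ctrl s p = Some (SC i u, S4 tag'); dict s p i = Some (v, tag)\<rbrakk> \<Longrightarrow>
    mem_step n k p s
      (if cas_L s i = (v, 0) then enter_CL p (SC i u) (At_S5 True) (write_L i (u, tag') s)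
       else enter_CL p (SC i u) (At_S5 False) s)"
| step_K2: "\<lbrakk>ctrl s p = Some (c, K2 site); dict s p (obj c) = Some (v, tag);
      fad (k + 1) (faid_R s tag) r x\<rbrakk> \<Longrightarrow>
    mem_step n k p s (goto p c (K4 site) (set_dict p (obj c) None (write_R tag x s)))"
| step_K4: "\<lbrakk>ctrl s p = Some (c, K4 site); fad (n + 1) (faid_C s (obj c)) r x;
      s' = write_C (obj c) x s\<rbrakk> \<Longrightarrow>
    mem_step n k p s (if r > 1 then return_CL p c site s' else goto p c (K5 site) s')"
| step_K5: "\<lbrakk>ctrl s p = Some (c, K5 site); cas_L s (obj c) = (v, tag)\<rbrakk> \<Longrightarrow>
    mem_step n k p s (if tag = 0 then return_CL p c site s else goto p c (K7 site v tag) s)"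
| step_K7: "\<lbrakk>ctrl s p = Some (c, K7 site v tag); fai (k + 1) (faid_R s tag) r x\<rbrakk> \<Longrightarrow>
    mem_step n k p s (goto p c (K8 site v tag) (write_R tag x s))"
| step_K8: "ctrl s p = Some (c, K8 site v tag) \<Longrightarrow>
    mem_step n k p s
      (if cas_L s (obj c) = (v, tag) then goto p c (K9 site v tag) s
       else goto p c (K11 site v tag) s)"
| step_K9: "ctrl s p = Some (c, K9 site v tag) \<Longrightarrow>
    mem_step n k p s
      (if faid_C s (obj c) = 0 then goto p c (K10 site v tag) s
       else goto p c (K11 site v tag) s)"
| step_K10: "ctrl s p = Some (c, K10 site v tag) \<Longrightarrow>
    mem_step n k p s
      (goto p c (K11 site v tag)
        (if cas_L s (obj c) = (v, tag) then write_L (obj c) (v, 0) s else s))"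
| step_K11: "\<lbrakk>ctrl s p = Some (c, K11 site v tag); fad (k + 1) (faid_R s tag) r x\<rbrakk> \<Longrightarrow>
    mem_step n k p s (return_CL p c site (write_R tag x s))"
| step_RD: "ctrl s p = Some (Read i, RD) \<Longrightarrow>
    mem_step n k p s (respond p (Read i) (Value (fst (cas_L s i))) s)"
| step_V2: "\<lbrakk>ctrl s p = Some (VL i, V2); dict s p i = Some (v, tag)\<rbrakk> \<Longrightarrow>
    mem_step n k p s
      (if snd (cas_L s i) \<in> {tag, 0} then respond p (VL i) (Bool True) s
       else enter_CL p (VL i) At_V3 s)"

fun legal_call :: "nat \<Rightarrow> 'u set \<Rightarrow> 'u call \<Rightarrow> bool" where
  "legal_call m U (SC i u) = (i \<in> {1..m} \<and> u \<in> U)"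
| "legal_call m U c = (obj c \<in> {1..m})"

inductive step :: "nat \<Rightarrow> nat \<Rightarrow> nat \<Rightarrow> 'u set \<Rightarrow> 'u config \<Rightarrow> 'u config \<Rightarrow> bool"
  for n m k :: nat and U :: "'u set" where
  invocation: "\<lbrakk>p \<in> {1..n}; idle s p; legal_call m U c\<rbrakk> \<Longrightarrow> step n m k U s (invoke p c s)"
| memory: "\<lbrakk>p \<in> {1..n}; mem_step n k p s s'\<rbrakk> \<Longrightarrow> step n m k U s s'"

definition initial :: "nat \<Rightarrow> nat \<Rightarrow> nat \<Rightarrow> (nat \<Rightarrow> 'u) \<Rightarrow> 'u config \<Rightarrow> bool" where
  "initial n m k u0 s \<longleftrightarrow>
     (\<forall>i\<in>{1..m}. cas_L s i = (u0 i, 0) \<and> faid_C s i = 0) \<and>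
     (\<forall>g\<in>{1..2 * k}. faid_R s g = 0) \<and>
     (\<forall>p\<in>{1..n}. idle s p \<and> (\<forall>i\<in>{1..m}. dict s p i = None)) \<and>
     outstanding s = {}"

text \<open>
  A finite or infinite execution with N events: \<open>\<sigma> t\<close> is the configuration after the first t
  events. Values of \<open>\<sigma>\<close> beyond N are irrelevant.
\<close>

definition execution ::
  "nat \<Rightarrow> nat \<Rightarrow> nat \<Rightarrow> 'u set \<Rightarrow> (nat \<Rightarrow> 'u) \<Rightarrow> (nat \<Rightarrow> 'u config) \<Rightarrow> enat \<Rightarrow> bool" where
  "execution n m k U u0 \<sigma> N \<longleftrightarrow>
     initial n m k u0 (\<sigma> 0) \<and> (\<forall>t. enat (Suc t) \<le> N \<longrightarrow> step n m k U (\<sigma> t) (\<sigma> (Suc t)))"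

end

theory Submission
  imports Defs
begin

text \<open>
  \<open>C[i]\<close> counts the processes that passed L2 and not yet K4 on object i, and \<open>R[g]\<close> counts
  the pairs (p, i) for which p announced g (L6 or K7) and has not yet withdrawn it (L9, K2 or
  K11). A process is counted at most once in \<open>C[i]\<close>, and a pair counted in \<open>R[g]\<close> is an
  outstanding LL, so the counters never overflow and vanish at a quiescent point. For the tag of
  \<open>L[i]\<close>: only a process counted in \<open>C[i]\<close> can write a nonzero tag, and the process that brings
  \<open>C[i]\<close> down to 0 enters K5. Hence while \<open>C[i] = 0\<close> either the tag is already 0 or some process
  is between K5 and K10 and bound to clear it; repetitions of tags are harmless for this argument.
\<close>

section \<open>Who is counted in each counter, and the invariant\<close>

text \<open>
  The dictionary entry is defined from L4 up to K3, so a process counted in \<open>C[i]\<close> without having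
  an entry is between L2 and L4 or between K3 and K4.
\<close>

fun counting_pc :: "'u pc \<Rightarrow> bool" where
  "counting_pc L3 = True"
| "counting_pc (K4 site) = True"
| "counting_pc l = False"

definition counted :: "'u config \<Rightarrow> nat \<Rightarrow> nat \<Rightarrow> bool" where
  "counted s p i \<longleftrightarrow>
     dict s p i \<noteq> None \<or>
     (case ctrl s p of None \<Rightarrow> False | Some (c, l) \<Rightarrow> obj c = i \<and> counting_pc l)"

text \<open>Outside K8 to K11 the dictionary entry itself records the announced tag, except at L6,
  where the entry exists but the increment is still to come. From K8 on the entry is gone and the
  program counter carries the tag. An entry with tag 0 matters only for \<open>g = 0\<close>, which
  is no index of R.\<close>

fun announced_pc :: "'u pc \<Rightarrow> 'u cell option \<Rightarrow> nat \<Rightarrow> bool" where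
  "announced_pc (L6 v tag) d g = False"
| "announced_pc (K8 site v tag) d g = (tag = g)"
| "announced_pc (K9 site v tag) d g = (tag = g)"
| "announced_pc (K10 site v tag) d g = (tag = g)"
| "announced_pc (K11 site v tag) d g = (tag = g)"
| "announced_pc l d g = (map_option snd d = Some g)"

definition announced :: "'u config \<Rightarrow> nat \<Rightarrow> nat \<Rightarrow> nat \<Rightarrow> bool" where
  "announced s p i g \<longleftrightarrow>
     (case ctrl s p of
        None \<Rightarrow> map_option snd (dict s p i) = Some g
      | Some (c, l) \<Rightarrow>
          if obj c = i then announced_pc l (dict s p i) g
          else map_option snd (dict s p i) = Some g)"

text \<open>Ties the tag carried by L6, L7 and L9 to the stored entry, so that the register changed
  is the one recorded. The last equation covers L2, L3 and CL from K4 on, where no entry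
  exists.\<close>

fun dict_at_pc :: "'u pc \<Rightarrow> 'u cell option \<Rightarrow> bool" where
  "dict_at_pc (L6 v tag) d = (d = Some (v, tag))"
| "dict_at_pc (L7 v tag) d = (d = Some (v, tag))"
| "dict_at_pc (L9 tag v') d = (\<exists>v. d = Some (v, tag))"
| "dict_at_pc S2 d = (d \<noteq> None)"
| "dict_at_pc (S3 tag') d = (d \<noteq> None)"
| "dict_at_pc (S4 tag') d = (d \<noteq> None)"
| "dict_at_pc (K2 site) d = (d \<noteq> None)"
| "dict_at_pc RD d = True"
| "dict_at_pc V2 d = (d \<noteq> None)"
| "dict_at_pc l d = (d = None)"

text \<open>The outstanding clauses charge each announcement to an outstanding LL, through the entry
  or, at K8 to K11, through the pending call. RD is exempt because Read may run without an
  LL.\<close>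

definition local_inv :: "nat \<Rightarrow> 'u config \<Rightarrow> nat \<Rightarrow> bool" where
  "local_inv m s p \<longleftrightarrow>
     (\<forall>i\<in>{1..m}. dict s p i \<noteq> None \<longrightarrow> (p, i) \<in> outstanding s) \<and>
     (\<forall>c l. ctrl s p = Some (c, l) \<longrightarrow>
        obj c \<in> {1..m} \<and> dict_at_pc l (dict s p (obj c)) \<and>
        (l \<noteq> RD \<longrightarrow> (p, obj c) \<in> outstanding s))"

text \<open>K5 qualifies for any content, as it is about to read it. From K7 to K10 the pair read
  must still be the content, so that the comparison at K8 and the CAS at K10 succeed.\<close>

fun clearing_pc :: "'u pc \<Rightarrow> 'u cell \<Rightarrow> bool" where
  "clearing_pc (K5 site) x = True"
| "clearing_pc (K7 site v tag) x = (x = (v, tag))"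
| "clearing_pc (K8 site v tag) x = (x = (v, tag))"
| "clearing_pc (K9 site v tag) x = (x = (v, tag))"
| "clearing_pc (K10 site v tag) x = (x = (v, tag))"
| "clearing_pc l x = False"

definition clearing :: "'u config \<Rightarrow> nat \<Rightarrow> nat \<Rightarrow> bool" where
  "clearing s p i \<longleftrightarrow>
     (case ctrl s p of None \<Rightarrow> False | Some (c, l) \<Rightarrow> obj c = i \<and> clearing_pc l (cas_L s i))"

definition global_inv :: "nat \<Rightarrow> nat \<Rightarrow> nat \<Rightarrow> 'u config \<Rightarrow> bool" where
  "global_inv n m k s \<longleftrightarrow>
     finite (outstanding s) \<and>
     (\<forall>p\<in>{1..n}. local_inv m s p) \<and>
     (\<forall>i\<in>{1..m}. faid_C s i = card {p \<in> {1..n}. counted s p i}) \<and>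
     (\<forall>g\<in>{1..2 * k}.
        faid_R s g = card {x \<in> {1..n} \<times> {1..m}. announced s (fst x) (snd x) g}) \<and>
     (\<forall>i\<in>{1..m}. faid_C s i = 0 \<longrightarrow> snd (cas_L s i) = 0 \<or> (\<exists>p\<in>{1..n}. clearing s p i))"

section \<open>Locality of a step\<close>

text \<open>R is left out: its indices are tags shared by all objects, and the balance lemmas
  account for it tag by tag.\<close>

definition frame :: "nat \<Rightarrow> nat \<Rightarrow> 'u config \<Rightarrow> 'u config \<Rightarrow> bool" where
  "frame p i s s' \<longleftrightarrow>
     (\<forall>q. q \<noteq> p \<longrightarrow> dict s' q = dict s q \<and> ctrl s' q = ctrl s q) \<and>
     (\<forall>j. j \<noteq> i \<longrightarrow> dict s' p j = dict s p j \<and> faid_C s' j = faid_C s j \<and> cas_L s' j = cas_L s j) \<and>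
     (\<forall>c l. ctrl s p = Some (c, l) \<or> ctrl s' p = Some (c, l) \<longrightarrow> obj c = i) \<and>
     (\<forall>x. x \<noteq> (p, i) \<longrightarrow> (x \<in> outstanding s' \<longleftrightarrow> x \<in> outstanding s))"

lemmas state_simps =
  goto_def respond_def write_L_def write_C_def write_R_def set_dict_def enter_CL_def

lemma return_CL_simps [simp]:
  "cas_L (return_CL p c site s) = cas_L s"
  "faid_C (return_CL p c site s) = faid_C s"
  "faid_R (return_CL p c site s) = faid_R s"
  "dict (return_CL p c site s) = dict s"
  "ctrl (return_CL p c site s) =
     (ctrl s)(p := (if site = At_L1 then Some (c, L2) else None))"
  by (cases site; simp add: state_simps)+

lemma outstanding_return_CL:
  "outstanding (return_CL p c site s) = outstanding s \<or>
   site \<noteq> At_L1 \<and> outstanding (return_CL p c site s) = outstanding s - {(p, obj c)}"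
  by (cases site) (auto simp: state_simps)

lemma outstanding_return_CL_other:
  "x \<noteq> (p, obj c) \<Longrightarrow> x \<in> outstanding (return_CL p c site s) \<longleftrightarrow> x \<in> outstanding s"
  using outstanding_return_CL[of p c site s] by auto

lemma outstanding_return_CLI:
  "\<lbrakk>(p, i) \<in> outstanding s; i \<noteq> obj c\<rbrakk> \<Longrightarrow> (p, i) \<in> outstanding (return_CL p c site s)"
  by (simp add: outstanding_return_CL_other)

lemma outstanding_return_CL_At_L1 [simp]:
  "outstanding (return_CL p c At_L1 s) = outstanding s"
  by (simp add: state_simps)

lemma frame_mem_step:
  assumes "mem_step n k p s s'" "ctrl s p = Some (c, l)"
  shows "frame p (obj c) s s'"
  using assms
  by cases (auto simp: frame_def state_simps outstanding_return_CL_other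
      split: option.split if_splits)

lemma frame_invoke:
  assumes "idle s p"
  shows "frame p (obj c) s (invoke p c s)"
  using assms
  by (cases c) (auto simp: frame_def idle_def state_simps Let_def
      split: option.split)

lemma local_inv_mem_step:
  assumes "mem_step n k p s s'" "local_inv m s p"
  shows "local_inv m s' p"
  using assms
  by cases (auto simp: local_inv_def state_simps intro!: outstanding_return_CLI
      split: option.split if_splits)

lemma local_inv_invoke:
  assumes "idle s p" "legal_call m U c" "local_inv m s p"
  shows "local_inv m (invoke p c s) p"
  using assms
  by (cases c) (auto simp: local_inv_def idle_def state_simps Let_def
      split: option.split)

section \<open>Effect of one step on the counters and the tag\<close>

text \<open>The bounds exclude overflow at L2 and K4, so these steps change C by exactly one. L3 and
  K3 only hand p over between program counter and entry. Sums avoid truncated subtraction.\<close>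

lemma balance_C_mem_step:
  assumes "mem_step n k p s s'" "local_inv m s p" "ctrl s p = Some (c, l)"
    and "of_bool (counted s p (obj c)) \<le> faid_C s (obj c)"
    and "faid_C s (obj c) < n + of_bool (counted s p (obj c))"
  shows "faid_C s' (obj c) + of_bool (counted s p (obj c)) =
         faid_C s (obj c) + of_bool (counted s' p (obj c))"
proof -
  have "dict_at_pc l (dict s p (obj c))"
    using assms(2,3) by (auto simp: local_inv_def)
  with assms(1,3-) show ?thesis
    by cases (auto simp: counted_def state_simps fai_def fad_def
        split: option.split if_splits)
qed

lemma balance_C_invoke:
  assumes "idle s p"
  shows "faid_C (invoke p c s) (obj c) + of_bool (counted s p (obj c)) =
         faid_C s (obj c) + of_bool (counted (invoke p c s) p (obj c))"
  using assms
  by (cases c) (auto simp: counted_def idle_def state_simps Let_def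
      split: option.split)

text \<open>L6 and K7 start an announcement, and L9, K2 and K11 end one. With \<open>g > 0\<close>,
  an entry with tag 0, such as the one written at L9, announces nothing.\<close>

lemma balance_R_mem_step:
  assumes "mem_step n k p s s'" "local_inv m s p" "ctrl s p = Some (c, l)" "g > 0"
    and "of_bool (announced s p (obj c) g) \<le> faid_R s g"
    and "(p, obj c) \<in> outstanding s \<Longrightarrow> faid_R s g < k + of_bool (announced s p (obj c) g)"
  shows "faid_R s' g + of_bool (announced s p (obj c) g) =
         faid_R s g + of_bool (announced s' p (obj c) g)"
proof -
  \<comment> \<open>Every program counter except RD lies within an outstanding LL, and RD leaves R
    alone.\<close>
  have dict: "dict_at_pc l (dict s p (obj c))"
    and bound: "l \<noteq> RD \<longrightarrow> faid_R s g < k + of_bool (announced s p (obj c) g)"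
    using assms(2,3,6) by (auto simp: local_inv_def)
  note facts = assms(3-5) dict bound
  from assms(1) show ?thesis
  proof cases
    case (step_L9 i tag v' r x)
    \<comment> \<open>Only \<open>R[tag]\<close> is decremented, whereas the facts bound
      \<open>R[g]\<close>.\<close>
    with facts show ?thesis
      by (cases "g = tag")
        (auto simp: announced_def state_simps fai_def fad_def split: option.split if_splits)
  qed (use facts in \<open>auto simp: announced_def state_simps fai_def fad_def
      split: option.split if_splits\<close>)
qed

lemma balance_R_invoke:
  assumes "idle s p" "g > 0"
  shows "faid_R (invoke p c s) g + of_bool (announced s p (obj c) g) =
         faid_R s g + of_bool (announced (invoke p c s) p (obj c) g)"
  using assms
  by (cases c) (auto simp: announced_def idle_def state_simps Let_def
      split: option.split)

text \<open>Nonzero tags are written only at S3 and S4, where p has an entry and is counted, so C is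
  positive. K10 writes tag 0.\<close>

lemma tag_mem_step:
  assumes "mem_step n k p s s'" "local_inv m s p" "ctrl s p = Some (c, l)"
    and "of_bool (counted s p (obj c)) \<le> faid_C s (obj c)"
    and "faid_C s' (obj c) = 0" "snd (cas_L s' (obj c)) \<noteq> 0"
  shows "cas_L s' (obj c) = cas_L s (obj c)"
  using assms
  by cases (auto simp: local_inv_def counted_def state_simps
      split: option.split_asm if_splits)

text \<open>If C was positive, the step is a K4 that returned 1, and p moves to K5. If C was 0, p at
  K5 reads the current nonzero tag, the tests at K8 and K9 succeed, and K10 is impossible since its
  CAS would leave tag 0.\<close>

lemma clearing_mem_step:
  assumes "mem_step n k p s s'" "local_inv m s p" "ctrl s p = Some (c, l)"
    and "of_bool (counted s p (obj c)) \<le> faid_C s (obj c)"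
    and "faid_C s (obj c) < n + of_bool (counted s p (obj c))"
    and "faid_C s' (obj c) = 0" "snd (cas_L s' (obj c)) \<noteq> 0"
    and "cas_L s' (obj c) = cas_L s (obj c)"
    and "faid_C s (obj c) \<noteq> 0 \<or> clearing s p (obj c)"
  shows "clearing s' p (obj c)"
  using assms
  by cases (auto simp: local_inv_def counted_def clearing_def state_simps fai_def fad_def
      split: option.split_asm if_splits)

lemma invoke_simps [simp]:
  "cas_L (invoke p c s) = cas_L s"
  "faid_C (invoke p c s) = faid_C s"
  "faid_R (invoke p c s) = faid_R s"
  by (cases c; auto simp: state_simps Let_def split: option.split)+

lemma announced_outstanding:
  assumes "local_inv m s p" "i \<in> {1..m}" "announced s p i g"
  shows "(p, i) \<in> outstanding s"
proof (cases "dict s p i")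
  case None
  then obtain c l where c: "ctrl s p = Some (c, l)" "obj c = i" "announced_pc l None g"
    using assms(3) by (auto simp: announced_def split: option.splits if_splits)
  \<comment> \<open>At RD only an entry could announce g, and there is none.\<close>
  then have "l \<noteq> RD" by auto
  then show ?thesis using assms(1) c by (auto simp: local_inv_def)
next
  case (Some x)
  then show ?thesis using assms by (auto simp: local_inv_def)
qed

section \<open>Counting and the absence of overflow\<close>

lemma card_Collect_remove:
  assumes "finite A" "a \<in> A"
  shows "card {x \<in> A. P x} = card {x \<in> A - {a}. P x} + of_bool (P a)"
proof (cases "P a")
  case True
  then have "{x \<in> A. P x} = insert a {x \<in> A - {a}. P x}" using assms by auto
  then show ?thesis using assms True by simp
next
  case False
  then have "{x \<in> A. P x} = {x \<in> A - {a}. P x}" by auto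
  then show ?thesis using False by simp
qed

lemma card_Collect_update:
  assumes "finite A" "a \<in> A" "\<And>x. x \<in> A \<Longrightarrow> x \<noteq> a \<Longrightarrow> P' x = P x"
  shows "card {x \<in> A. P' x} + of_bool (P a) = card {x \<in> A. P x} + of_bool (P' a)"
proof -
  have "{x \<in> A - {a}. P' x} = {x \<in> A - {a}. P x}" using assms(3) by auto
  then show ?thesis
    using card_Collect_remove[OF assms(1,2), of P] card_Collect_remove[OF assms(1,2), of P']
    by simp
qed

text \<open>At most n - 1 processes other than p are counted, which leaves room for p.\<close>

lemma C_bounds:
  assumes "global_inv n m k s" "p \<in> {1..n}" "i \<in> {1..m}"
  shows "of_bool (counted s p i) \<le> faid_C s i"
    and "faid_C s i < n + of_bool (counted s p i)"
proof -
  have C: "faid_C s i = card {q \<in> {1..n} - {p}. counted s q i} + of_bool (counted s p i)"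
    using assms card_Collect_remove[of "{1..n}" p "\<lambda>q. counted s q i"]
    by (simp add: global_inv_def)
  have "card {q \<in> {1..n} - {p}. counted s q i} \<le> card ({1..n} - {p})"
    by (rule card_mono) auto
  also have "\<dots> < n" using assms(2) by simp
  finally show "of_bool (counted s p i) \<le> faid_C s i" "faid_C s i < n + of_bool (counted s p i)"
    using C by auto
qed

text \<open>All other pairs announcing g have an outstanding LL; if (p, i) has one too, at most k -
  1 are left for them.\<close>

lemma R_bounds:
  assumes "global_inv n m k s" "card (outstanding s) \<le> k"
    and "p \<in> {1..n}" "i \<in> {1..m}" "g \<in> {1..2 * k}"
  shows "of_bool (announced s p i g) \<le> faid_R s g"
    and "(p, i) \<in> outstanding s \<Longrightarrow> faid_R s g < k + of_bool (announced s p i g)"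
proof -
  let ?A = "{1..n} \<times> {1..m}"
  let ?B = "{x \<in> ?A - {(p, i)}. announced s (fst x) (snd x) g}"
  have R: "faid_R s g = card ?B + of_bool (announced s p i g)"
    using assms card_Collect_remove[of ?A "(p, i)" "\<lambda>x. announced s (fst x) (snd x) g"]
    by (simp add: global_inv_def)
  then show "of_bool (announced s p i g) \<le> faid_R s g" by simp
  assume out: "(p, i) \<in> outstanding s"
  \<comment> \<open>Without finiteness the bound by k would say nothing, as \<open>card\<close> of
    an infinite set is 0.\<close>
  have fin: "finite (outstanding s)" using assms(1) by (simp add: global_inv_def)
  have "?B \<subseteq> outstanding s - {(p, i)}"
    using assms(1) announced_outstanding by (fastforce simp: global_inv_def)
  then have "card ?B \<le> card (outstanding s - {(p, i)})" using fin by (intro card_mono) auto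
  also have "\<dots> < card (outstanding s)" using fin out by (rule card_Diff1_less)
  finally show "faid_R s g < k + of_bool (announced s p i g)" using R assms(2) by simp
qed

section \<open>Preservation of the invariant\<close>

text \<open>Separates the case analysis of the program from the counting: preservation of the
  invariant uses nothing else about a step.\<close>

definition step_effect :: "nat \<Rightarrow> nat \<Rightarrow> nat \<Rightarrow> nat \<Rightarrow> 'u config \<Rightarrow> 'u config \<Rightarrow> bool" where
  "step_effect m k p i s s' \<longleftrightarrow>
     frame p i s s' \<and>
     local_inv m s' p \<and>
     faid_C s' i + of_bool (counted s p i) = faid_C s i + of_bool (counted s' p i) \<and>
     (\<forall>g\<in>{1..2 * k}. faid_R s' g + of_bool (announced s p i g) =
                     faid_R s g + of_bool (announced s' p i g)) \<and>
     (faid_C s' i = 0 \<and> snd (cas_L s' i) \<noteq> 0 \<longrightarrow>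
        cas_L s' i = cas_L s i \<and> (faid_C s i \<noteq> 0 \<or> clearing s p i \<longrightarrow> clearing s' p i))"

lemma step_effect_step:
  assumes "step n m k U s s'" "global_inv n m k s" "card (outstanding s) \<le> k"
  obtains p i where "p \<in> {1..n}" "i \<in> {1..m}" "step_effect m k p i s s'"
  using assms(1)
proof cases
  case (invocation p c)
  have i: "obj c \<in> {1..m}" using invocation by (cases c) auto
  have loc: "local_inv m s p" using assms(2) invocation by (auto simp: global_inv_def)
  \<comment> \<open>An invocation changes neither C nor L, so with p not clearing before, the last
    implication of \<open>step_effect\<close> is vacuous.\<close>
  have idle_p: "\<not> clearing s p (obj c)" using invocation by (simp add: clearing_def idle_def)
  have "step_effect m k p (obj c) s s'"
    unfolding step_effect_def invocation(1)
    using frame_invoke[OF invocation(3)] local_inv_invoke[OF invocation(3,4) loc]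
      balance_C_invoke[OF invocation(3)] balance_R_invoke[OF invocation(3)] idle_p
    by simp
  then show ?thesis using that i invocation by blast
next
  case (memory p)
  obtain c l where c: "ctrl s p = Some (c, l)" using memory(2) by cases auto
  have loc: "local_inv m s p" using assms(2) memory by (auto simp: global_inv_def)
  then have i: "obj c \<in> {1..m}" using c by (auto simp: local_inv_def)
  note C = C_bounds[OF assms(2) memory(1) i]
  note R = R_bounds[OF assms(2,3) memory(1) i]
  note st = memory(2) loc c
  have "\<forall>g\<in>{1..2 * k}. faid_R s' g + of_bool (announced s p (obj c) g) =
                     faid_R s g + of_bool (announced s' p (obj c) g)"
    using balance_R_mem_step[OF st _ R] by simp
  then have "step_effect m k p (obj c) s s'"
    unfolding step_effect_def
    using frame_mem_step[OF memory(2) c] local_inv_mem_step[OF memory(2) loc]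
      balance_C_mem_step[OF st C] tag_mem_step[OF st C(1)] clearing_mem_step[OF st C]
    by blast
  then show ?thesis using that i memory by blast
qed

lemma global_inv_step_effect:
  assumes inv: "global_inv n m k s" and p: "p \<in> {1..n}" and i: "i \<in> {1..m}"
    and eff: "step_effect m k p i s s'"
  shows "global_inv n m k s'"
proof -
  have fr: "frame p i s s'" using eff by (simp add: step_effect_def)
  have dict: "dict s' q = dict s q" and ctrl: "ctrl s' q = ctrl s q" if "q \<noteq> p" for q
    using fr that by (auto simp: frame_def)
  have other: "dict s' p j = dict s p j" "faid_C s' j = faid_C s j" "cas_L s' j = cas_L s j"
    if "j \<noteq> i" for j
    using fr that by (auto simp: frame_def)
  have obj: "ctrl s p = Some (c, l) \<Longrightarrow> obj c = i" "ctrl s' p = Some (c, l) \<Longrightarrow> obj c = i" for c l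
    using fr by (auto simp: frame_def)
  have out: "x \<in> outstanding s' \<longleftrightarrow> x \<in> outstanding s" if "x \<noteq> (p, i)" for x
    using fr that unfolding frame_def by blast
  have counted: "counted s' q j = counted s q j" if "q \<noteq> p \<or> j \<noteq> i" for q j
  proof (cases "q = p")
    case True
    then show ?thesis
      using that other(1)[of j] obj by (auto simp: counted_def split: option.split)
  next
    case False
    then show ?thesis by (simp add: counted_def dict ctrl)
  qed
  have announced: "announced s' q j g = announced s q j g" if "q \<noteq> p \<or> j \<noteq> i" for q j g
  proof (cases "q = p")
    case True
    then show ?thesis
      using that other(1)[of j] obj by (auto simp: announced_def split: option.split)
  next
    case False
    then show ?thesis by (simp add: announced_def dict[OF False] ctrl[OF False] cong: option.case_cong)
  qed
  \<comment> \<open>\<open>clearing\<close> compares with the content of \<open>L[j]\<close>, hence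
    the second premise.\<close>
  have clearing: "clearing s' q j = clearing s q j"
    if "q \<noteq> p \<or> j \<noteq> i" "cas_L s' j = cas_L s j" for q j
  proof (cases "q = p")
    case True
    then show ?thesis
      using that obj by (auto simp: clearing_def split: option.split)
  next
    case False
    then show ?thesis using that(2) by (simp add: clearing_def ctrl[OF False] cong: option.case_cong)
  qed
  have "outstanding s' \<subseteq> insert (p, i) (outstanding s)" using out by blast
  then have "finite (outstanding s')"
    using inv by (auto simp: global_inv_def intro: finite_subset)
  moreover have "local_inv m s' q" if "q \<in> {1..n}" for q
  proof (cases "q = p")
    case True
    then show ?thesis using eff by (simp add: step_effect_def)
  next
    case False
    then show ?thesis
      using inv that dict ctrl out by (simp add: global_inv_def local_inv_def)
  qed
  moreover have "faid_C s' j = card {q \<in> {1..n}. counted s' q j}" if j: "j \<in> {1..m}" for j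
  proof (cases "j = i")
    case True
    have "card {q \<in> {1..n}. counted s' q i} + of_bool (counted s p i) =
          card {q \<in> {1..n}. counted s q i} + of_bool (counted s' p i)"
      by (rule card_Collect_update) (use p counted in auto)
    then show ?thesis using True inv i eff by (simp add: global_inv_def step_effect_def)
  next
    case False
    then show ?thesis using inv j other(2) counted by (simp add: global_inv_def)
  qed
  moreover have "faid_R s' g = card {x \<in> {1..n} \<times> {1..m}. announced s' (fst x) (snd x) g}"
    if g: "g \<in> {1..2 * k}" for g
  proof -
    \<comment> \<open>The unreduced \<open>fst (p, i)\<close> and \<open>snd (p, i)\<close> match
      the form of \<open>card_Collect_update\<close>.\<close>
    have "card {x \<in> {1..n} \<times> {1..m}. announced s' (fst x) (snd x) g} +
            of_bool (announced s (fst (p, i)) (snd (p, i)) g) =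
          card {x \<in> {1..n} \<times> {1..m}. announced s (fst x) (snd x) g} +
            of_bool (announced s' (fst (p, i)) (snd (p, i)) g)"
      by (rule card_Collect_update) (use p i announced in auto)
    moreover have "faid_R s g = card {x \<in> {1..n} \<times> {1..m}. announced s (fst x) (snd x) g}"
      using inv g by (simp add: global_inv_def)
    moreover have "faid_R s' g + of_bool (announced s p i g) =
                   faid_R s g + of_bool (announced s' p i g)"
      using eff g by (simp add: step_effect_def)
    ultimately show ?thesis by simp
  qed
  moreover have "snd (cas_L s' j) = 0 \<or> (\<exists>q\<in>{1..n}. clearing s' q j)"
    if j: "j \<in> {1..m}" and C0: "faid_C s' j = 0" for j
    unfolding disj_imp
  proof
    assume tag: "snd (cas_L s' j) \<noteq> 0"
    have L: "cas_L s' j = cas_L s j"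
      using eff C0 tag other(3) by (cases "j = i") (auto simp: step_effect_def)
    show "\<exists>q\<in>{1..n}. clearing s' q j"
    \<comment> \<open>Either p takes on or keeps the duty of clearing, or C was 0 before and a
      clearing process of the old configuration still qualifies, as \<open>L[j]\<close> is
      unchanged.\<close>
    proof (cases "j = i \<and> (faid_C s i \<noteq> 0 \<or> clearing s p i)")
      case True
      then show ?thesis using eff C0 tag p by (auto simp: step_effect_def)
    next
      case False
      then have "faid_C s j = 0" using C0 other(2) by (cases "j = i") auto
      then have "snd (cas_L s j) = 0 \<or> (\<exists>q\<in>{1..n}. clearing s q j)"
        using inv j unfolding global_inv_def by blast
      then obtain q where q: "q \<in> {1..n}" "clearing s q j" using tag L by auto
      then have "q \<noteq> p \<or> j \<noteq> i" using False by auto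
      then show ?thesis using clearing L q by blast
    qed
  qed
  ultimately show ?thesis by (simp add: global_inv_def)
qed

section \<open>Executions and quiescent points\<close>

lemma global_inv_initial:
  assumes "initial n m k u0 s"
  shows "global_inv n m k s"
  using assms
  by (auto simp: global_inv_def initial_def local_inv_def counted_def announced_def idle_def)

theorem theorem15:
  fixes n m k t :: nat and U :: "'u set" and u0 :: "nat \<Rightarrow> 'u"
    and \<sigma> :: "nat \<Rightarrow> 'u config" and N :: enat
  assumes "k \<ge> 1"
    and "\<forall>i\<in>{1..m}. u0 i \<in> U"
    and "execution n m k U u0 \<sigma> N"
    and "\<forall>t'. enat t' \<le> N \<longrightarrow> card (outstanding (\<sigma> t')) \<le> k"
    and "enat t \<le> N"
    and "\<forall>p\<in>{1..n}. idle (\<sigma> t) p \<and> (\<forall>i\<in>{1..m}. (p, i) \<notin> outstanding (\<sigma> t))"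
  shows "(\<forall>i\<in>{1..m}. faid_C (\<sigma> t) i = 0) \<and>
         (\<forall>g\<in>{1..2 * k}. faid_R (\<sigma> t) g = 0) \<and>
         (\<forall>i\<in>{1..m}. snd (cas_L (\<sigma> t) i) = 0)"
proof -
  have "enat t \<le> N \<Longrightarrow> global_inv n m k (\<sigma> t)" for t
  proof (induction t)
    case 0
    then show ?case using assms(3) global_inv_initial by (auto simp: execution_def)
  next
    case (Suc t)
    then have t: "enat t \<le> N" by (meson Suc_ile_eq order_less_imp_le)
    have "step n m k U (\<sigma> t) (\<sigma> (Suc t))" using assms(3) Suc.prems by (simp add: execution_def)
    then show ?case
      using step_effect_step Suc.IH[OF t] assms(4) t global_inv_step_effect by metis
  qed
  then have inv: "global_inv n m k (\<sigma> t)" using assms(5) by blast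
  have ctrl: "ctrl (\<sigma> t) p = None" if "p \<in> {1..n}" for p
    using that assms(6) by (simp add: idle_def)
  \<comment> \<open>Idleness alone does not empty the dictionaries; the absence of outstanding LLs
    does, since every entry belongs to one.\<close>
  have dict: "dict (\<sigma> t) p i = None" if "p \<in> {1..n}" "i \<in> {1..m}" for p i
  proof -
    have "local_inv m (\<sigma> t) p" using inv that(1) by (simp add: global_inv_def)
    then have "\<forall>i\<in>{1..m}. dict (\<sigma> t) p i \<noteq> None \<longrightarrow> (p, i) \<in> outstanding (\<sigma> t)"
      unfolding local_inv_def by (rule conjunct1)
    then show ?thesis using that assms(6) by blast
  qed
  have none: "\<not> counted (\<sigma> t) p i" "\<not> announced (\<sigma> t) p i g" "\<not> clearing (\<sigma> t) p i"
    if "p \<in> {1..n}" "i \<in> {1..m}" for p i g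
    using ctrl[OF that(1)] dict[OF that]
    by (simp_all add: counted_def announced_def clearing_def)
  have C_card: "faid_C (\<sigma> t) i = card {p \<in> {1..n}. counted (\<sigma> t) p i}"
    and tag: "faid_C (\<sigma> t) i = 0 \<Longrightarrow>
      snd (cas_L (\<sigma> t) i) = 0 \<or> (\<exists>p\<in>{1..n}. clearing (\<sigma> t) p i)"
    if "i \<in> {1..m}" for i
    using inv that unfolding global_inv_def by blast+
  have C: "faid_C (\<sigma> t) i = 0" if i: "i \<in> {1..m}" for i
  proof -
    have "{p \<in> {1..n}. counted (\<sigma> t) p i} = {}" using none(1) i by blast
    then show ?thesis using C_card[OF i] by (simp only: card.empty)
  qed
  moreover have "faid_R (\<sigma> t) g = 0" if g: "g \<in> {1..2 * k}" for g
  proof -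
    have "{x \<in> {1..n} \<times> {1..m}. announced (\<sigma> t) (fst x) (snd x) g} = {}"
      using none(2) by (simp add: set_eq_iff)
    moreover have "faid_R (\<sigma> t) g =
        card {x \<in> {1..n} \<times> {1..m}. announced (\<sigma> t) (fst x) (snd x) g}"
      using inv g unfolding global_inv_def by blast
    ultimately show ?thesis by (simp only: card.empty)
  qed
  moreover have "snd (cas_L (\<sigma> t) i) = 0" if i: "i \<in> {1..m}" for i
    \<comment> \<open>As C is 0, a nonzero tag would require a clearing process, but all are
      idle.\<close>
    using tag[OF i C[OF i]] none(3) i by blast
  ultimately show ?thesis by blast
qed

end
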